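(* Let $(X,d,\preceq)$ be an ordered metric space, let $E$ be an $\underline{\mathrm O}$-complete subspace of $X$, and let $\ast\in\mathfrak B_n$. Let $F:X^n\to X$ and $g:X\to X$ be two mappings. Suppose that the following conditions hold: (i) $F(X^n)\subseteq g(X)\cap E$; (ii) $F$ has the $g$-monotone property; (iii) $F$ and $g$ are $(\ast,\underline{\mathrm O})$-compatible; (iv) $g$ is $\underline{\mathrm O}$-continuous; (v) either $F$ is $\underline{\mathrm O}$-continuous or $(E,d,\preceq)$ has the $g$-DCL property; (vi$'$) there exist $x^{(0)}_1,\dots,x^{(0)}_n\in X$ such that $g(x^{(0)}_i)\succeq F(x^{(0)}_{i_1},x^{(0)}_{i_2},\dots,x^{(0)}_{i_n})$ for each $i\in I_n$; (vii) there exists $\varphi\in\Omega$ such that $$\frac1n\sum_{i=1}^n d\big(F(x_{i_1},\dots,x_{i_n}),F(y_{i_1},\dots,y_{i_n})\big)\le\varphi\Big(\frac1n\sum_{i=1}^n d(gx_i,gy_i)\Big)$$ for all $x_1,\dots,x_n,y_1,\dots,y_n\in X$ with [$g(x_i)\preceq g(y_i)$ for each $i\in I_n$] or [$g(x_i)\succeq g(y_i)$ for each $i\in I_n$]; or, alternatively to (vii), (vii$'$) there exists $\varphi\in\Omega$ such that $$\max_{i\in I_n} d\big(F(x_{i_1},\dots,x_{i_n}),F(y_{i_1},\dots,y_{i_n})\big)\le\varphi\Big(\max_{i\in I_n} d(gx_i,gy_i)\Big)$$ for all $x_1,\dots,x_n,y_1,\dots,y_n\in X$ with [$g(x_i)\preceq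 g(y_i)$ for each $i\in I_n$] or [$g(x_i)\succeq g(y_i)$ for each $i\in I_n$]. Then $F$ and $g$ have an $\ast$-coincidence point.
   Context: Throughout, $n\ge 2$ is a fixed integer, $I_n=\{1,\dots,n\}$, and sequences are indexed by $m\in\mathbb N_0$. An ordered metric space $(X,d,\preceq)$ is a nonempty set $X$ with a metric $d$ and a partial order $\preceq$; $x\succeq y$ means $y\preceq x$. A subspace is a nonempty subset with the restricted metric and order. We write $gx$ for $g(x)$. $\mathfrak B_n$ is the set of all binary operations $\ast:I_n\times I_n\to I_n$; for $\ast\in\mathfrak B_n$ write $i_k:=\ast(i,k)$. A sequence $\{x^{(m)}\}$ is decreasing if $x^{(m)}\succeq x^{(m+1)}$ for all $m$. $x^{(m)}\downarrow x$ means that $\{x^{(m)}\}$ is decreasing and converges to $x$ in $d$. $E$ is $\underline{\mathrm O}$-complete if every decreasing Cauchy sequence in $E$ converges in $E$. $g$ is $\underline{\mathrm O}$-continuous if for every $x\in X$ and every sequence in $X$ with $x^{(m)}\downarrow x$ one has $g(x^{(m)})\to g(x)$. $F$ is $\underline{\mathrm O}$-continuous if for every $(x_1,\dots,x_n)\in X^n$ and all sequences $\{x_1^{(m)}\},\dots,\{x_n^{(m)}\}$ in $X$ with $x_i^{(m)}\downarrow x_i$ for each $i$, one has $F(x_1^{(m)},\dots,x_n^{(m)})\to F(x_1,\dots,x_n)$. $(E,d,\preceq)$ has the $g$-DCL property if for every sequence $\{x^{(m)}\}$ in $E$ and $x\in E$ with $x^{(m)}\downarrow x$, one has $g(x^{(m)})\succeq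 g(x)$ for all $m$. $F$ has the $g$-monotone property if, for all $x_1,\dots,x_n,y_1,\dots,y_n\in X$, $g(x_i)\preceq g(y_i)$ for all $i\in I_n$ implies $F(x_1,\dots,x_n)\preceq F(y_1,\dots,y_n)$. $F$ and $g$ are $(\ast,\underline{\mathrm O})$-compatible if for any sequences $\{x_1^{(m)}\},\dots,\{x_n^{(m)}\}$ in $X$ and any $z_1,\dots,z_n\in X$ with $g(x_i^{(m)})\downarrow z_i$ and $F(x_{i_1}^{(m)},\dots,x_{i_n}^{(m)})\downarrow z_i$ for each $i\in I_n$, one has $\lim_{m\to\infty}d\big(gF(x_{i_1}^{(m)},\dots,x_{i_n}^{(m)}),F(gx_{i_1}^{(m)},\dots,gx_{i_n}^{(m)})\big)=0$ for each $i\in I_n$. $\Omega$ is the set of functions $\varphi:[0,\infty)\to[0,\infty)$ with $\varphi(t)<t$ and $\limsup_{r\to t^+}\varphi(r)<t$ for each $t>0$. $(x_1,\dots,x_n)\in X^n$ is an $\ast$-coincidence point of $F$ and $g$ if $F(x_{i_1},\dots,x_{i_n})=g(x_i)$ for each $i\in I_n$. *)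

theory Defs
  imports "HOL-Analysis.Analysis"
begin

text \<open>
  An ordered metric space is a type of sort \<open>{metric_space, order}\<close>; no compatibility between
  the metric and the order is assumed. The index set with \<open>n\<close> elements is a finite type \<open>'n\<close>, so
  \<open>n = CARD('n)\<close>, an \<open>n\<close>-tuple is a function \<open>'n \<Rightarrow> 'a\<close>, and a binary operation on the index set
  is a function \<open>star :: 'n \<Rightarrow> 'n \<Rightarrow> 'n\<close>. The tuple \<open>(x_{i_1}, \<dots>, x_{i_n})\<close> with
  \<open>i_k = star i k\<close> is \<open>\<lambda>k. x (star i k)\<close>. A tuple of sequences is a function \<open>'n \<Rightarrow> nat \<Rightarrow> 'a\<close>.
\<close>

definition tends_down :: "(nat \<Rightarrow> 'a::{metric_space,order}) \<Rightarrow> 'a \<Rightarrow> bool" where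
  "tends_down s x \<longleftrightarrow> decseq s \<and> s \<longlonglongrightarrow> x"

definition O_complete :: "'a::{metric_space,order} set \<Rightarrow> bool" where
  "O_complete E \<longleftrightarrow>
    (\<forall>s. (\<forall>m. s m \<in> E) \<and> decseq s \<and> Cauchy s \<longrightarrow> (\<exists>x\<in>E. s \<longlonglongrightarrow> x))"

definition O_continuous :: "('a::{metric_space,order} \<Rightarrow> 'a) \<Rightarrow> bool" where
  "O_continuous g \<longleftrightarrow> (\<forall>x s. tends_down s x \<longrightarrow> (\<lambda>m. g (s m)) \<longlonglongrightarrow> g x)"

definition O_continuous_n :: "(('n::finite \<Rightarrow> 'a::{metric_space,order}) \<Rightarrow> 'a) \<Rightarrow> bool" where
  "O_continuous_n F \<longleftrightarrow>
    (\<forall>x s. (\<forall>i. tends_down (s i) (x i)) \<longrightarrow> (\<lambda>m. F (\<lambda>i. s i m)) \<longlonglongrightarrow> F x)"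

definition g_DCL :: "('a::{metric_space,order} \<Rightarrow> 'a) \<Rightarrow> 'a set \<Rightarrow> bool" where
  "g_DCL g E \<longleftrightarrow>
    (\<forall>s. \<forall>x\<in>E. (\<forall>m. s m \<in> E) \<and> tends_down s x \<longrightarrow> (\<forall>m. g (s m) \<ge> g x))"

definition g_monotone ::
    "(('n::finite \<Rightarrow> 'a::order) \<Rightarrow> 'a) \<Rightarrow> ('a \<Rightarrow> 'a) \<Rightarrow> bool" where
  "g_monotone F g \<longleftrightarrow> (\<forall>x y. (\<forall>i. g (x i) \<le> g (y i)) \<longrightarrow> F x \<le> F y)"

definition O_compatible ::
    "('n::finite \<Rightarrow> 'n \<Rightarrow> 'n) \<Rightarrow> (('n \<Rightarrow> 'a::{metric_space,order}) \<Rightarrow> 'a) \<Rightarrow> ('a \<Rightarrow> 'a) \<Rightarrow> bool" where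
  "O_compatible star F g \<longleftrightarrow>
    (\<forall>s z. (\<forall>i. tends_down (\<lambda>m. g (s i m)) (z i) \<and>
                tends_down (\<lambda>m. F (\<lambda>k. s (star i k) m)) (z i)) \<longrightarrow>
      (\<forall>i. (\<lambda>m. dist (g (F (\<lambda>k. s (star i k) m))) (F (\<lambda>k. g (s (star i k) m)))) \<longlonglongrightarrow> 0))"

text \<open>
  Only the values on \<open>[0, \<infinity>)\<close> matter. The upper limit is taken in the extended reals, since
  \<open>Limsup\<close> requires a complete lattice.
\<close>

definition Omega :: "(real \<Rightarrow> real) set" where
  "Omega = {\<phi>. (\<forall>t\<ge>0. \<phi> t \<ge> 0) \<and>
    (\<forall>t>0. \<phi> t < t \<and> Limsup (at_right t) (\<lambda>r. ereal (\<phi> r)) < ereal t)}"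

definition coincidence_point ::
    "('n::finite \<Rightarrow> 'n \<Rightarrow> 'n) \<Rightarrow> (('n \<Rightarrow> 'a) \<Rightarrow> 'a) \<Rightarrow> ('a \<Rightarrow> 'a) \<Rightarrow> ('n \<Rightarrow> 'a) \<Rightarrow> bool" where
  "coincidence_point star F g x \<longleftrightarrow> (\<forall>i. F (\<lambda>k. x (star i k)) = g (x i))"

end

theory Submission
  imports Defs
begin

text \<open>
  Write \<open>T x = (\<lambda>i. F (\<lambda>k. x (star i k)))\<close> and \<open>G x = (\<lambda>i. g (x i))\<close> for tuples \<open>x\<close>. A coincidence
  point of \<open>F\<close> and \<open>g\<close> is a tuple with \<open>T x = G x\<close>, so the theorem is a one-variable coincidence
  theorem on the space of tuples with the product order. Its metric \<open>D\<close> is the mean or the maximum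
  of the coordinate distances, and the only facts about \<open>D\<close> that matter hold for both: it satisfies
  the triangle inequality, and it is comparable with the coordinate distances.

  The two contraction hypotheses also lead to one and the same condition of Meir--Keeler type: for
  every \<open>\<epsilon> > 0\<close> there is \<open>\<delta> > 0\<close> such that \<open>D (G x) (G y) < \<epsilon> + \<delta>\<close> implies \<open>D (T x) (T y) < \<epsilon>\<close>
  whenever \<open>G x\<close> and \<open>G y\<close> are comparable. (For \<open>D (G x) (G y) = 0\<close> the value \<open>\<phi> 0\<close> tells nothing;
  there \<open>g\<close>-monotonicity in both directions gives \<open>T x = T y\<close>.)

  Since \<open>range F \<subseteq> range g\<close>, there are tuples \<open>x m\<close> with \<open>G (x (m + 1)) = T (x m)\<close>, and by
  monotonicity \<open>y m = G (x m)\<close> decreases. The Meir--Keeler condition makes \<open>y\<close> a Cauchy sequence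
  (\<open>Meir_Keeler_Cauchy\<close>), so it has a limit \<open>z\<close> by completeness of \<open>E\<close>. Compatibility says that
  \<open>T (y m)\<close> and \<open>G (y (m + 1))\<close> become arbitrarily close, and continuity of \<open>g\<close> sends the latter
  to \<open>G z\<close>. Hence \<open>T (y m)\<close> tends to \<open>G z\<close>. It also tends to \<open>T z\<close>: either by continuity of \<open>F\<close>, or
  because the DCL property makes \<open>G (y m)\<close> and \<open>G z\<close> comparable, and \<open>T\<close> does not increase the
  distance there. So \<open>T z = G z\<close>.
\<close>

section \<open>Meir--Keeler sequences\<close>

text \<open>
  The upper limit controls \<open>\<phi>\<close> only to the right of \<open>t\<close>, the inequality \<open>\<phi> t < t\<close> controls it at
  \<open>t\<close>, and \<open>\<phi> r < r\<close> is enough for smaller \<open>r\<close>.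
\<close>

lemma Omega_Meir_Keeler:
  assumes "\<phi> \<in> Omega" and "t > 0"
  shows "\<exists>\<delta>>0. \<forall>r. 0 < r \<and> r < t + \<delta> \<longrightarrow> \<phi> r < t"
proof -
  have lt: "\<phi> r < r" if "r > 0" for r
    using assms(1) that by (simp add: Omega_def)
  have "Limsup (at_right t) (\<lambda>r. ereal (\<phi> r)) < ereal t"
    using assms by (simp add: Omega_def)
  then have "eventually (\<lambda>r. ereal (\<phi> r) < ereal t) (at_right t)"
    by (rule Limsup_lessD)
  then obtain b where b: "b > t" "\<And>r. t < r \<Longrightarrow> r < b \<Longrightarrow> \<phi> r < t"
    by (auto simp: eventually_at_right_field)
  have "\<phi> r < t" if "0 < r" "r < t + (b - t)" for r
    using lt[of r] b(2)[of r] that by (cases r t rule: linorder_cases) auto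
  with b(1) show ?thesis
    by (intro exI[of _ "b - t"]) auto
qed

text \<open>
  The steps \<open>D (y m) (y (m + 1))\<close> decrease, and their limit cannot be some \<open>t > 0\<close>, since a step
  shorter than \<open>t + \<delta>\<close> is followed by one shorter than \<open>t\<close>. Once the steps are shorter than \<open>\<delta>\<close>,
  the bound \<open>D (y m) (y n) < \<epsilon> + \<delta>\<close> persists as \<open>n\<close> grows: if \<open>D (y m) (y n) < \<epsilon> + \<delta>\<close>, then
  \<open>D (y (m + 1)) (y (n + 1)) < \<epsilon>\<close>, and the step from \<open>y m\<close> to \<open>y (m + 1)\<close> adds less than \<open>\<delta>\<close>.
\<close>

lemma Meir_Keeler_Cauchy:
  fixes D :: "'b \<Rightarrow> 'b \<Rightarrow> real" and y :: "nat \<Rightarrow> 'b"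
  assumes nonneg: "\<And>u v. D u v \<ge> 0" and refl: "\<And>u. D u u = 0"
    and triangle: "\<And>u v w. D u w \<le> D u v + D v w"
    and MK: "\<And>\<epsilon>. \<epsilon> > 0 \<Longrightarrow>
      \<exists>\<delta>>0. \<forall>m n. m \<le> n \<and> D (y m) (y n) < \<epsilon> + \<delta> \<longrightarrow> D (y (Suc m)) (y (Suc n)) < \<epsilon>"
    and "\<epsilon> > 0"
  shows "\<exists>N. \<forall>m\<ge>N. \<forall>n\<ge>m. D (y m) (y n) < \<epsilon>"
proof -
  define a where "a m = D (y m) (y (Suc m))" for m
  have step: "a (Suc m) \<le> a m" for m
  proof (rule ccontr)
    assume "\<not> a (Suc m) \<le> a m"
    then have less: "a m < a (Suc m)" by simp
    then have "a (Suc m) > 0"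
      using nonneg[of "y m" "y (Suc m)"] by (simp add: a_def)
    from MK[OF this] obtain \<delta> where "\<delta> > 0"
      "\<And>m' n. m' \<le> n \<Longrightarrow> D (y m') (y n) < a (Suc m) + \<delta> \<Longrightarrow> D (y (Suc m')) (y (Suc n)) < a (Suc m)"
      by blast
    from this(1) this(2)[of m "Suc m"] less show False
      by (simp add: a_def)
  qed
  then have dec: "decseq a"
    by (rule decseq_SucI)
  then obtain t where t: "a \<longlonglongrightarrow> t" "\<And>m. t \<le> a m"
    using decseq_convergent[of a 0] nonneg by (metis a_def)
  have "t \<ge> 0"
    using t(1) by (rule LIMSEQ_le_const) (simp add: a_def nonneg)
  have "t = 0"
  proof (rule ccontr)
    assume "t \<noteq> 0"
    with \<open>t \<ge> 0\<close> have "t > 0" by simp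
    from MK[OF this] obtain \<delta> where \<delta>: "\<delta> > 0"
      "\<And>m n. m \<le> n \<Longrightarrow> D (y m) (y n) < t + \<delta> \<Longrightarrow> D (y (Suc m)) (y (Suc n)) < t"
      by blast
    have "eventually (\<lambda>m. a m < t + \<delta>) sequentially"
      using t(1) \<delta>(1) by (intro order_tendstoD(2)) auto
    then obtain m where "a m < t + \<delta>"
      by (auto simp: eventually_sequentially)
    then have "a (Suc m) < t"
      using \<delta>(2)[of m "Suc m"] by (simp add: a_def)
    with t(2)[of "Suc m"] show False by simp
  qed
  \<comment> \<open>The invariant bound \<open>\<epsilon> / 2 + \<delta>\<close> is at most \<open>\<epsilon>\<close> because \<open>\<delta> \<le> \<epsilon> / 2\<close>.\<close>
  have "\<epsilon> / 2 > 0" using \<open>\<epsilon> > 0\<close> by simp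
  from MK[OF this] obtain \<delta>0 where \<delta>0: "\<delta>0 > 0"
    "\<And>m n. m \<le> n \<Longrightarrow> D (y m) (y n) < \<epsilon> / 2 + \<delta>0 \<Longrightarrow> D (y (Suc m)) (y (Suc n)) < \<epsilon> / 2"
    by blast
  define \<delta> where "\<delta> = min \<delta>0 (\<epsilon> / 2)"
  have \<delta>: "\<delta> > 0" "\<delta> \<le> \<delta>0" "\<delta> \<le> \<epsilon> / 2"
    using \<delta>0(1) \<open>\<epsilon> > 0\<close> by (auto simp: \<delta>_def)
  have "eventually (\<lambda>m. a m < \<delta>) sequentially"
    using t(1) \<open>t = 0\<close> \<delta>(1) by (intro order_tendstoD(2)) auto
  then obtain N where N: "\<And>m. m \<ge> N \<Longrightarrow> a m < \<delta>"
    by (auto simp: eventually_sequentially)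
  have "D (y m) (y n) < \<epsilon> / 2 + \<delta>" if "m \<ge> N" "n \<ge> m" for m n
    using that(2)
  proof (induction n rule: dec_induct)
    case base
    show ?case using \<open>\<epsilon> > 0\<close> \<delta>(1) by (simp add: refl)
  next
    case (step n)
    have "D (y (Suc m)) (y (Suc n)) < \<epsilon> / 2"
      using \<delta>0(2)[of m n] step \<delta>(2) by simp
    with N[OF that(1)] triangle[of "y m" "y (Suc n)" "y (Suc m)"] show ?case
      by (simp add: a_def)
  qed
  with \<delta>(3) show ?thesis
    by (intro exI[of _ N] allI impI) fastforce
qed

section \<open>Metrics on tuples\<close>

text \<open>
  What the mean and the maximum of the coordinate distances have in common. The two bounds make
  convergence with respect to \<open>D\<close> the same as convergence in every coordinate, and they force
  \<open>D\<close> to be nonnegative and to vanish exactly on the diagonal.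
\<close>

locale tuple_metric =
  fixes D :: "('n::finite \<Rightarrow> 'a::metric_space) \<Rightarrow> ('n \<Rightarrow> 'a) \<Rightarrow> real" and K :: real
  assumes K_pos: "K > 0"
    and dist_le: "dist (x i) (y i) \<le> K * D x y"
    and le_sum: "D x y \<le> (\<Sum>i\<in>UNIV. dist (x i) (y i))"
    and triangle: "D x z \<le> D x y + D y z"
begin

lemma nonneg: "D x y \<ge> 0"
proof -
  have "0 \<le> K * D x y"
    using dist_le[of x undefined y] zero_le_dist order_trans by blast
  with K_pos show ?thesis by (simp add: zero_le_mult_iff)
qed

lemma refl: "D x x = 0"
  using nonneg[of x x] le_sum[of x x] by simp

lemma tendsto_zeroI:
  assumes "\<And>i. (\<lambda>m. s m i) \<longlonglongrightarrow> x i"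
  shows "(\<lambda>m. D (s m) x) \<longlonglongrightarrow> 0"
proof -
  have "(\<lambda>m. \<Sum>i\<in>UNIV. dist (s m i) (x i)) \<longlonglongrightarrow> (\<Sum>i\<in>(UNIV :: 'n set). 0)"
    by (intro tendsto_sum tendsto_dist_iff[THEN iffD1] assms)
  then have "(\<lambda>m. \<Sum>i\<in>UNIV. dist (s m i) (x i)) \<longlonglongrightarrow> 0" by simp
  then show ?thesis
    by (rule tendsto_sandwich[OF _ _ tendsto_const, rotated 2]) (auto simp: nonneg le_sum)
qed

lemma tendsto_zeroD:
  assumes "(\<lambda>m. D (s m) x) \<longlonglongrightarrow> 0"
  shows "(\<lambda>m. s m i) \<longlonglongrightarrow> x i"
proof -
  have "(\<lambda>m. K * D (s m) x) \<longlonglongrightarrow> 0"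
    using tendsto_mult_right_zero[OF assms] .
  then have "(\<lambda>m. dist (s m i) (x i)) \<longlonglongrightarrow> 0"
    by (rule tendsto_sandwich[OF _ _ tendsto_const, rotated 2]) (auto simp: dist_le)
  then show ?thesis by (rule tendsto_dist_iff[THEN iffD2])
qed

lemma Cauchy_coordinate:
  assumes "\<And>\<epsilon>. \<epsilon> > 0 \<Longrightarrow> \<exists>N. \<forall>m\<ge>N. \<forall>n\<ge>m. D (s m) (s n) < \<epsilon>"
  shows "Cauchy (\<lambda>m. s m i)"
proof (rule metric_CauchyI)
  fix e :: real assume "e > 0"
  then have "e / K > 0" using K_pos by simp
  from assms[OF this] obtain N where N: "\<And>m n. m \<ge> N \<Longrightarrow> n \<ge> m \<Longrightarrow> D (s m) (s n) < e / K"
    by blast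
  have le: "dist (s m i) (s n i) < e" if "m \<ge> N" "n \<ge> m" for m n
    using dist_le[of "s m" i "s n"] N[OF that] K_pos by (simp add: field_simps)
  have "dist (s m i) (s n i) < e" if "m \<ge> N" "n \<ge> N" for m n
    using le[of m n] le[of n m] that by (cases "m \<le> n") (auto simp: dist_commute)
  then show "\<exists>N. \<forall>m\<ge>N. \<forall>n\<ge>N. dist (s m i) (s n i) < e" by blast
qed

end

lemma tuple_metric_mean:
  "tuple_metric (\<lambda>(x :: 'n::finite \<Rightarrow> 'a::metric_space) y.
      1 / real CARD('n) * (\<Sum>i\<in>UNIV. dist (x i) (y i))) (real CARD('n))"
proof
  show "real CARD('n) > 0" by simp
next
  fix x y :: "'n \<Rightarrow> 'a" and i
  show "dist (x i) (y i) \<le> real CARD('n) * (1 / real CARD('n) * (\<Sum>i\<in>UNIV. dist (x i) (y i)))"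
    using member_le_sum[of i UNIV "\<lambda>i. dist (x i) (y i)"] by simp
next
  fix x y :: "'n \<Rightarrow> 'a"
  have "1 / real CARD('n) \<le> 1"
    using zero_less_card_finite[where 'a='n] by simp
  then show "1 / real CARD('n) * (\<Sum>i\<in>UNIV. dist (x i) (y i)) \<le> (\<Sum>i\<in>UNIV. dist (x i) (y i))"
    by (intro mult_left_le_one_le sum_nonneg) auto
next
  fix x y z :: "'n \<Rightarrow> 'a"
  have "(\<Sum>i\<in>UNIV. dist (x i) (z i)) \<le> (\<Sum>i\<in>UNIV. dist (x i) (y i)) + (\<Sum>i\<in>UNIV. dist (y i) (z i))"
    unfolding sum.distrib[symmetric] by (intro sum_mono dist_triangle)
  then show "1 / real CARD('n) * (\<Sum>i\<in>UNIV. dist (x i) (z i))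
      \<le> 1 / real CARD('n) * (\<Sum>i\<in>UNIV. dist (x i) (y i))
        + 1 / real CARD('n) * (\<Sum>i\<in>UNIV. dist (y i) (z i))"
    unfolding distrib_left[symmetric] by (intro mult_left_mono) auto
qed

lemma tuple_metric_Max:
  "tuple_metric (\<lambda>(x :: 'n::finite \<Rightarrow> 'a::metric_space) y. MAX i. dist (x i) (y i)) 1"
proof
  fix x y :: "'n \<Rightarrow> 'a" and i
  show "dist (x i) (y i) \<le> 1 * (MAX i. dist (x i) (y i))" by simp
next
  fix x y :: "'n \<Rightarrow> 'a"
  show "(MAX i. dist (x i) (y i)) \<le> (\<Sum>i\<in>UNIV. dist (x i) (y i))"
    by (intro Max.boundedI) (auto intro: member_le_sum)
next
  fix x y z :: "'n \<Rightarrow> 'a"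
  have "dist (x i) (z i) \<le> (MAX i. dist (x i) (y i)) + (MAX i. dist (y i) (z i))" for i
    by (rule order_trans[OF dist_triangle[of _ _ "y i"]]) (intro add_mono Max_ge; simp)
  then show "(MAX i. dist (x i) (z i)) \<le> (MAX i. dist (x i) (y i)) + (MAX i. dist (y i) (z i))"
    by (intro Max.boundedI) auto
qed simp

section \<open>Coincidence points\<close>

text \<open>
  The common form of both cases of the theorem, for an arbitrary tuple metric \<open>D\<close>. From the
  contraction hypothesis the argument extracts the Meir--Keeler condition \<open>MK\<close>, which yields both
  the Cauchy property of the iteration and the nonexpansiveness used in the DCL case.
\<close>

theorem coincidence_point_exists:
  fixes D :: "('n::finite \<Rightarrow> 'a::{metric_space,order}) \<Rightarrow> ('n \<Rightarrow> 'a) \<Rightarrow> real"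
    and E :: "'a set"
    and star :: "'n \<Rightarrow> 'n \<Rightarrow> 'n"
  assumes D: "tuple_metric D K"
    and complete: "O_complete E"
    and range: "range F \<subseteq> range g \<inter> E"
    and mono: "g_monotone F g"
    and compat: "O_compatible star F g"
    and cont: "O_continuous g"
    and cont_or_DCL: "O_continuous_n F \<or> g_DCL g E"
    and start: "\<And>i. g (x0 i) \<ge> F (\<lambda>k. x0 (star i k))"
    and \<phi>: "\<phi> \<in> Omega"
    and contraction: "\<And>x y. (\<forall>i. g (x i) \<le> g (y i)) \<or> (\<forall>i. g (x i) \<ge> g (y i)) \<Longrightarrow>
      D (\<lambda>i. F (\<lambda>k. x (star i k))) (\<lambda>i. F (\<lambda>k. y (star i k))) \<le> \<phi> (D (\<lambda>i. g (x i)) (\<lambda>i. g (y i)))"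
  shows "\<exists>x. coincidence_point star F g x"
proof -
  interpret tuple_metric D K by (rule D)
  define T where "T x = (\<lambda>i. F (\<lambda>k. x (star i k)))" for x
  define G where "G x = (\<lambda>i. g (x i))" for x :: "'n \<Rightarrow> 'a"
  have T_mono: "T x \<le> T y" if "G x \<le> G y" for x y
    using mono that by (auto simp: T_def G_def g_monotone_def le_fun_def)

  have MK: "\<exists>\<delta>>0. \<forall>x y. G x \<ge> G y \<and> D (G x) (G y) < \<epsilon> + \<delta> \<longrightarrow> D (T x) (T y) < \<epsilon>"
    if "\<epsilon> > 0" for \<epsilon>
  proof -
    from Omega_Meir_Keeler[OF \<phi> that] obtain \<delta> where \<delta>: "\<delta> > 0"
      "\<And>r. 0 < r \<Longrightarrow> r < \<epsilon> + \<delta> \<Longrightarrow> \<phi> r < \<epsilon>"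
      by blast
    have "D (T x) (T y) < \<epsilon>" if le: "G x \<ge> G y" and small: "D (G x) (G y) < \<epsilon> + \<delta>" for x y
    proof (cases "D (G x) (G y) = 0")
      case True
      then have "G x = G y"
        using dist_le[of "G x" _ "G y"] by (intro ext) simp
      then have "T x = T y"
        by (intro antisym T_mono) simp_all
      with \<open>\<epsilon> > 0\<close> show ?thesis by (simp add: refl)
    next
      case False
      with nonneg[of "G x" "G y"] small have "\<phi> (D (G x) (G y)) < \<epsilon>"
        by (intro \<delta>(2)) auto
      with contraction[of x y] le show ?thesis
        by (auto simp: T_def G_def le_fun_def)
    qed
    with \<delta>(1) show ?thesis by blast
  qed
  \<comment> \<open>With \<open>\<epsilon> = D (T x) (T y)\<close>, the inequality \<open>D (G x) (G y) < \<epsilon>\<close> would give \<open>\<epsilon> < \<epsilon>\<close>.\<close>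
  have nonexpansive: "D (T x) (T y) \<le> D (G x) (G y)" if "G x \<ge> G y" for x y
  proof (rule ccontr)
    assume "\<not> ?thesis"
    then have "D (G x) (G y) < D (T x) (T y)" by simp
    moreover from this have "D (T x) (T y) > 0"
      using nonneg[of "G x" "G y"] by simp
    ultimately show False
      using MK[of "D (T x) (T y)"] that by fastforce
  qed

  have "\<exists>x'. G x' = T x" for x
  proof -
    have "\<forall>i. \<exists>u. g u = T x i"
    proof
      fix i
      have "T x i \<in> range g"
        using range by (auto simp: T_def)
      then show "\<exists>u. g u = T x i" by (auto elim!: rangeE)
    qed
    then obtain x' where "\<forall>i. g (x' i) = T x i"
      by (auto dest: choice)
    then show ?thesis by (intro exI[of _ x']) (simp add: G_def)
  qed
  then obtain succ where succ: "\<And>x. G (succ x) = T x"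
    by metis
  define x where "x m = (succ ^^ m) x0" for m
  define y where "y m = G (x m)" for m
  have y_Suc: "y (Suc m) = T (x m)" for m
    by (simp add: y_def x_def succ)
  have y_dec: "y (Suc m) \<le> y m" for m
  proof (induction m)
    case 0
    show ?case
      using start by (simp add: y_Suc) (simp add: y_def x_def T_def G_def le_fun_def)
  next
    case (Suc m)
    then show ?case by (metis y_def y_Suc T_mono)
  qed
  then have dec: "decseq y" by (rule decseq_SucI)
  have y_E: "y (Suc m) i \<in> E" for m i
    using range by (auto simp: y_Suc T_def)

  have "\<exists>N. \<forall>m\<ge>N. \<forall>n\<ge>m. D (y m) (y n) < \<epsilon>" if "\<epsilon> > 0" for \<epsilon>
  proof (rule Meir_Keeler_Cauchy[OF nonneg refl triangle _ that])
    fix \<epsilon> :: real assume "\<epsilon> > 0"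
    from MK[OF this] show "\<exists>\<delta>>0. \<forall>m n. m \<le> n \<and> D (y m) (y n) < \<epsilon> + \<delta>
        \<longrightarrow> D (y (Suc m)) (y (Suc n)) < \<epsilon>"
      using decseqD[OF dec] by (metis y_Suc y_def)
  qed
  then have Cauchy: "Cauchy (\<lambda>m. y m i)" for i
    by (rule Cauchy_coordinate)
  have dec_i: "decseq (\<lambda>m. y m i)" for i
    using y_dec by (intro decseq_SucI) (simp add: le_fun_def)
  \<comment> \<open>The initial tuple \<open>y 0\<close> need not lie in \<open>E\<close>, so completeness is applied from index 1 on.\<close>
  have "\<exists>z\<in>E. (\<lambda>m. y (Suc m) i) \<longlonglongrightarrow> z" for i
  proof -
    have "Cauchy (\<lambda>m. y (Suc m) i)"
      using Cauchy_subseq_Cauchy[OF Cauchy[of i], of Suc] by (simp add: strict_mono_Suc_iff comp_def)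
    moreover have "decseq (\<lambda>m. y (Suc m) i)"
      using y_dec by (intro decseq_SucI) (simp add: le_fun_def)
    ultimately show ?thesis
      using complete[unfolded O_complete_def, rule_format, of "\<lambda>m. y (Suc m) i"] y_E by simp
  qed
  then obtain z where z_E: "\<And>i. z i \<in> E" and z_lim: "\<And>i. (\<lambda>m. y (Suc m) i) \<longlonglongrightarrow> z i"
    by metis
  have down: "tends_down (\<lambda>m. y m i) (z i)" for i
    using LIMSEQ_imp_Suc[OF z_lim[of i]] dec_i by (simp add: tends_down_def)
  have down_Suc: "tends_down (\<lambda>m. y (Suc m) i) (z i)" for i
    using z_lim[of i] dec_i[of i] by (simp add: tends_down_def decseq_Suc_iff)
  have g_lim: "(\<lambda>m. g (y (Suc m) i)) \<longlonglongrightarrow> g (z i)" for i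
    using cont down_Suc by (auto simp: O_continuous_def)

  have gap: "(\<lambda>m. dist (g (y (Suc m) i)) (T (y m) i)) \<longlonglongrightarrow> 0" for i
  proof -
    have "tends_down (\<lambda>m. g (x m i)) (z i)" for i
      using down[of i] by (simp add: y_def G_def)
    moreover have "tends_down (\<lambda>m. F (\<lambda>k. x m (star i k))) (z i)" for i
      using down_Suc[of i] by (simp add: y_Suc T_def)
    ultimately have "(\<lambda>m. dist (g (F (\<lambda>k. x m (star i k)))) (F (\<lambda>k. g (x m (star i k))))) \<longlonglongrightarrow> 0"
      using compat[unfolded O_compatible_def, rule_format, of "\<lambda>i m. x m i" z i] by simp
    then show ?thesis
      by (simp add: y_Suc) (simp add: y_def T_def G_def)
  qed
  have T_lim: "(\<lambda>m. T (y m) i) \<longlonglongrightarrow> g (z i)" for i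
  proof -
    have "(\<lambda>m. dist (g (y (Suc m) i)) (T (y m) i) + dist (g (y (Suc m) i)) (g (z i))) \<longlonglongrightarrow> 0 + 0"
      by (intro tendsto_add gap tendsto_dist_iff[THEN iffD1] g_lim)
    then have "(\<lambda>m. dist (g (y (Suc m) i)) (T (y m) i) + dist (g (y (Suc m) i)) (g (z i))) \<longlonglongrightarrow> 0"
      by simp
    then have "(\<lambda>m. dist (T (y m) i) (g (z i))) \<longlonglongrightarrow> 0"
      by (rule tendsto_sandwich[OF _ _ tendsto_const, rotated 2]) (auto simp: dist_triangle3)
    then show ?thesis by (rule tendsto_dist_iff[THEN iffD2])
  qed

  \<comment> \<open>The index is shifted because the DCL property speaks of sequences in \<open>E\<close>.\<close>
  have T_lim': "(\<lambda>m. T (y (Suc m)) i) \<longlonglongrightarrow> T z i" for i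
    using cont_or_DCL
  proof
    assume F: "O_continuous_n F"
    show ?thesis
      using F[unfolded O_continuous_n_def, rule_format,
          of "\<lambda>k m. y (Suc m) (star i k)" "\<lambda>k. z (star i k)"] down_Suc
      by (simp add: T_def)
  next
    assume DCL: "g_DCL g E"
    have "g (y (Suc m) i) \<ge> g (z i)" for m i
      using DCL[unfolded g_DCL_def, rule_format, of "z i" "\<lambda>m. y (Suc m) i"] down_Suc y_E z_E
      by simp
    then have le: "G z \<le> G (y (Suc m))" for m
      by (simp add: G_def le_fun_def)
    have "(\<lambda>m. D (G (y (Suc m))) (G z)) \<longlonglongrightarrow> 0"
      using g_lim by (intro tendsto_zeroI) (simp add: G_def)
    then have "(\<lambda>m. D (T (y (Suc m))) (T z)) \<longlonglongrightarrow> 0"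
      by (rule tendsto_sandwich[OF _ _ tendsto_const, rotated 2]) (auto simp: nonneg nonexpansive[OF le])
    then show ?thesis by (rule tendsto_zeroD)
  qed
  have "T z i = g (z i)" for i
    using T_lim'[of i] LIMSEQ_Suc[OF T_lim[of i]] by (rule LIMSEQ_unique)
  then show ?thesis
    by (auto simp: coincidence_point_def T_def)
qed

theorem theorem2:
  fixes E :: "'a::{metric_space,order} set"
    and star :: "'n::finite \<Rightarrow> 'n \<Rightarrow> 'n"
    and F :: "('n \<Rightarrow> 'a) \<Rightarrow> 'a"
    and g :: "'a \<Rightarrow> 'a"
  assumes "CARD('n) \<ge> 2"
    and "E \<noteq> {}"
    and "O_complete E"
    and "range F \<subseteq> range g \<inter> E"
    and "g_monotone F g"
    and "O_compatible star F g"
    and "O_continuous g"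
    and "O_continuous_n F \<or> g_DCL g E"
    and "\<exists>x0. \<forall>i. g (x0 i) \<ge> F (\<lambda>k. x0 (star i k))"
    and "(\<exists>\<phi>\<in>Omega. \<forall>x y. (\<forall>i. g (x i) \<le> g (y i)) \<or> (\<forall>i. g (x i) \<ge> g (y i)) \<longrightarrow>
            1 / real CARD('n) * (\<Sum>i\<in>UNIV. dist (F (\<lambda>k. x (star i k))) (F (\<lambda>k. y (star i k))))
              \<le> \<phi> (1 / real CARD('n) * (\<Sum>i\<in>UNIV. dist (g (x i)) (g (y i)))))
       \<or> (\<exists>\<phi>\<in>Omega. \<forall>x y. (\<forall>i. g (x i) \<le> g (y i)) \<or> (\<forall>i. g (x i) \<ge> g (y i)) \<longrightarrow>
            (MAX i. dist (F (\<lambda>k. x (star i k))) (F (\<lambda>k. y (star i k))))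
              \<le> \<phi> (MAX i. dist (g (x i)) (g (y i))))"
  shows "\<exists>x. coincidence_point star F g x"
proof -
  obtain x0 where start: "\<And>i. g (x0 i) \<ge> F (\<lambda>k. x0 (star i k))"
    using assms(9) by blast
  show ?thesis
    using assms(10)
  proof (elim disjE bexE)
    fix \<phi> assume "\<phi> \<in> Omega" and contraction: "\<forall>x y. (\<forall>i. g (x i) \<le> g (y i)) \<or> (\<forall>i. g (x i) \<ge> g (y i)) \<longrightarrow>
            1 / real CARD('n) * (\<Sum>i\<in>UNIV. dist (F (\<lambda>k. x (star i k))) (F (\<lambda>k. y (star i k))))
              \<le> \<phi> (1 / real CARD('n) * (\<Sum>i\<in>UNIV. dist (g (x i)) (g (y i))))"
    show ?thesis
      by (rule coincidence_point_exists[OF tuple_metric_mean assms(3-8), OF start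
            \<open>\<phi> \<in> Omega\<close>]) (use contraction in blast)
  next
    fix \<phi> assume "\<phi> \<in> Omega" and contraction: "\<forall>x y. (\<forall>i. g (x i) \<le> g (y i)) \<or> (\<forall>i. g (x i) \<ge> g (y i)) \<longrightarrow>
            (MAX i. dist (F (\<lambda>k. x (star i k))) (F (\<lambda>k. y (star i k))))
              \<le> \<phi> (MAX i. dist (g (x i)) (g (y i)))"
    show ?thesis
      by (rule coincidence_point_exists[OF tuple_metric_Max assms(3-8), OF start
            \<open>\<phi> \<in> Omega\<close>]) (use contraction in blast)
  qed
qed

end
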